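(* Let $X$ be a real Banach space, $C\subset X$ a nonempty closed bounded convex set with $\delta=\mathrm{diam}(C)$, $f:X\to\mathbb{R}$ a convex, continuously Fréchet differentiable function, and $g:X\to(-\infty,\infty]$ a proper, lower semicontinuous, convex function with $C\subset\{x\in X:g(x)<\infty\}$. Put $\varphi=f+g$, assume that $\varphi$ attains its minimum over $C$, and put $\varphi^*=\min_{x\in C}\varphi(x)$. Let $\{x_k\}_{k\ge0}$ be a sequence generated by the generalized Frank-Wolfe algorithm from an arbitrary $x_0\in C$ (the subproblem defining $\bar x_k$ being solvable for each $k$), with each stepsize selected by line minimization search, i.e. $\gamma_k\in[0,1]$ is a minimizer of $\gamma\mapsto f(x_k+\gamma(\bar x_k-x_k))+g(x_k+\gamma(\bar x_k-x_k))$ over $[0,1]$. Assume there exists $\sigma\in(1,2]$ such that the curvature constant of order $\sigma$ of $f$ over $C$, $C_f^{(\sigma)}$, is finite. Then, for $k\ge1$, with $\theta_0=\varphi(x_0)-\varphi^*$, $$\varphi(x_k)-\varphi^*\le\frac{\theta_0}{\left(1+\frac1\sigma\,\theta_0^{\frac1{\sigma-1}}\,(C_f^{(\sigma)})^{\frac1{1-\sigma}}\,k\right)^{\sigma-1}}=O\left(\frac1{k^{\sigma-1}}\right).$$ In particular: - If $f'$ is $\nu$-Hölder continuous ($\nu\in(0,1]$) with constant $L_\nu$, then $$\varphi(x_k)-\varphi^*\le\frac{\theta_0}{\left(1+\frac1{1+\nu}\,\theta_0^{\frac1\nu}\,(L_\nu\delta^{1+\nu})^{-\frac1\nu}\,k\right)^{\nu}}=O\left(\frac1{k^\nu}\right).$$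 - If $f'$ is Lipschitz continuous with constant $L$, then $$\varphi(x_k)-\varphi^*\le\frac{\theta_0}{1+\frac{\theta_0}{2L\delta^2}\,k}=O\left(\frac1k\right).$$
   Context: $\langle\cdot,\cdot\rangle$ is the pairing between the dual $X^*$ and $X$. Generalized Frank-Wolfe algorithm for $\min_{x\in C}\varphi(x)=f(x)+g(x)$: given $x_0\in C$, for each $k\ge0$ choose $\bar x_k\in C$ to be a minimizer of $x\mapsto\langle f'(x_k),x\rangle+g(x)$ over $C$, and set $x_{k+1}=x_k+\gamma_k(\bar x_k-x_k)$. For $\sigma\in(1,2]$, the curvature constant of order $\sigma$ of $f$ over $C$ is $$C_f^{(\sigma)}=\sup\Big\{\frac{\sigma}{\gamma^\sigma}\big(f(y)-f(x)-\langle f'(x),y-x\rangle\big): x,s\in C,\ \gamma\in(0,1],\ y=x+\gamma(s-x)\Big\}\in[0,\infty].$$ $f'$ is $\nu$-Hölder continuous with constant $L_\nu>0$ if $\|f'(x)-f'(y)\|\le L_\nu\|x-y\|^\nu$ for all $x,y$; Lipschitz with constant $L>0$ is the case $\nu=1$. $\mathrm{diam}(C)=\sup\{\|u-v\|:u,v\in C\}$. *)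

theory Defs
  imports "HOL-Analysis.Analysis" "HOL-Library.Landau_Symbols"
begin

definition proper_fun :: "('a \<Rightarrow> ereal) \<Rightarrow> bool" where
  "proper_fun g \<longleftrightarrow> (\<forall>x. g x \<noteq> -\<infinity>) \<and> (\<exists>x. g x < \<infinity>)"

definition lower_semicontinuous :: "('a::topological_space \<Rightarrow> ereal) \<Rightarrow> bool" where
  "lower_semicontinuous g \<longleftrightarrow> (\<forall>x. g x \<le> Liminf (at x) g)"

(* Intended for functions that never take the value -\<infinity>; the boundary cases u = 0 and
   v = 0 are harmless because 0 * \<infinity> = 0 in ereal. *)
definition convex_ereal :: "('a::real_vector \<Rightarrow> ereal) \<Rightarrow> bool" where
  "convex_ereal g \<longleftrightarrow>
    (\<forall>x y u v. 0 \<le> u \<longrightarrow> 0 \<le> v \<longrightarrow> u + v = 1 \<longrightarrow>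
       g (u *\<^sub>R x + v *\<^sub>R y) \<le> ereal u * g x + ereal v * g y)"

definition curvature_const ::
  "real \<Rightarrow> ('a::real_normed_vector \<Rightarrow> real) \<Rightarrow> ('a \<Rightarrow> 'a \<Rightarrow>\<^sub>L real) \<Rightarrow> 'a set \<Rightarrow> ereal" where
  "curvature_const \<sigma> f f' C =
     Sup {ereal (\<sigma> / \<gamma> powr \<sigma> * (f y - f x - blinfun_apply (f' x) (y - x))) | x s \<gamma> y.
            x \<in> C \<and> s \<in> C \<and> 0 < \<gamma> \<and> \<gamma> \<le> 1 \<and> y = x + \<gamma> *\<^sub>R (s - x)}"

definition holder_with ::
  "real \<Rightarrow> real \<Rightarrow> ('a::real_normed_vector \<Rightarrow> 'b::real_normed_vector) \<Rightarrow> bool" where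
  "holder_with \<nu> L h \<longleftrightarrow> (\<forall>x y. norm (h x - h y) \<le> L * norm (x - y) powr \<nu>)"

definition generalized_frank_wolfe ::
  "('a::real_normed_vector \<Rightarrow> 'a \<Rightarrow>\<^sub>L real) \<Rightarrow> ('a \<Rightarrow> ereal) \<Rightarrow> 'a set
    \<Rightarrow> (nat \<Rightarrow> 'a) \<Rightarrow> (nat \<Rightarrow> 'a) \<Rightarrow> (nat \<Rightarrow> real) \<Rightarrow> bool" where
  "generalized_frank_wolfe f' g C x xbar \<gamma> \<longleftrightarrow>
     x 0 \<in> C \<and>
     (\<forall>k. is_arg_min (\<lambda>z. ereal (blinfun_apply (f' (x k)) z) + g z) (\<lambda>z. z \<in> C) (xbar k) \<and>
          x (Suc k) = x k + \<gamma> k *\<^sub>R (xbar k - x k))"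

definition line_minimization ::
  "('a::real_vector \<Rightarrow> ereal) \<Rightarrow> (nat \<Rightarrow> 'a) \<Rightarrow> (nat \<Rightarrow> 'a) \<Rightarrow> (nat \<Rightarrow> real) \<Rightarrow> bool" where
  "line_minimization \<phi> x xbar \<gamma> \<longleftrightarrow>
     (\<forall>k. is_arg_min (\<lambda>t. \<phi> (x k + t *\<^sub>R (xbar k - x k))) (\<lambda>t. t \<in> {0..1}) (\<gamma> k))"

(* The bound for a finite curvature constant c and k \<ge> 1.  For c = 0 the factor
   c powr (1 / (1 - \<sigma>)) has a negative exponent and means \<infinity>, which makes the bound 0
   (also when \<theta> = 0).  HOL has 0 powr a = 0 instead, which would turn the bound into \<theta>. *)
definition fw_bound :: "real \<Rightarrow> real \<Rightarrow> real \<Rightarrow> nat \<Rightarrow> real" where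
  "fw_bound \<sigma> c \<theta> k =
     (if c = 0 then 0
      else \<theta> / (1 + 1 / \<sigma> * \<theta> powr (1 / (\<sigma> - 1)) * c powr (1 / (1 - \<sigma>)) * real k) powr (\<sigma> - 1))"

end

theory Submission
  imports Defs
begin

text \<open>Write \<open>\<theta> k\<close> for the gap \<open>\<phi> (x k) - \<phi>_min\<close>. Convexity of \<open>f\<close> bounds the
  Frank-Wolfe gap of \<open>x k\<close> below by \<open>\<theta> k\<close>; with line minimization and the curvature bound \<open>c\<close>
  this gives \<open>\<theta> (k + 1) \<le> \<theta> k - t * \<theta> k + c * t powr \<sigma> / \<sigma>\<close> for every \<open>t\<close> in the unit interval.
  Taking the best \<open>t\<close> and using \<open>(1 + s) powr a \<le> 1 + a * s\<close> for \<open>0 \<le> a \<le> 1\<close>, this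
  becomes \<open>\<theta> (k + 1) \<le> F 1 (\<theta> k)\<close>, where \<open>F k\<close> is the claimed bound after \<open>k\<close> steps as a
  function of the initial gap. Since \<open>F 1\<close> is monotone and \<open>F 1 \<circ> F k = F (k + 1)\<close>, the bound
  follows. A Hoelder derivative has curvature constant at most \<open>L * \<delta> powr (1 + \<nu>)\<close>
  of order \<open>1 + \<nu>\<close>.\<close>

section \<open>Scalar recursions and their decay rates\<close>

lemma powr_one_plus_le:
  fixes a t :: real
  assumes "0 \<le> a" "a \<le> 1" "0 \<le> t"
  shows "(1 + t) powr a \<le> 1 + a * t"
  \<comment> \<open>Weighted AM-GM for the numbers \<open>1 + t\<close> and \<open>1\<close> with
    weights \<open>a\<close> and \<open>1 - a\<close>.\<close>
  using Youngs_inequality_0[of a "1 - a" "1 + t" 1] assms by (simp add: algebra_simps)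

text \<open>In terms of \<open>p = \<theta> k powr (1 / a)\<close> the recursion says that, as long
  as \<open>p\<close> stays positive, \<open>1 / p\<close> grows by at least \<open>b\<close> per
  step. Summing these increments gives the bound.\<close>

lemma rate_of_recursion:
  fixes \<theta> :: "nat \<Rightarrow> real"
  assumes "0 < a" "0 \<le> b" and nonneg: "\<And>k. 0 \<le> \<theta> k"
    and rec: "\<And>k. \<theta> (Suc k) \<le> \<theta> k / (1 + b * \<theta> k powr (1 / a)) powr a"
  shows "\<theta> k \<le> \<theta> 0 / (1 + b * \<theta> 0 powr (1 / a) * real k) powr a"
proof (induction k)
  case 0
  show ?case by simp
next
  case (Suc k)
  define w p where "w = \<theta> 0 powr (1 / a)" and "p = \<theta> k powr (1 / a)"
  have w: "0 \<le> w" "\<theta> 0 = w powr a" and p: "0 \<le> p" "\<theta> k = p powr a"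
    using assms by (auto simp: w_def p_def powr_powr)
  have pos: "0 < 1 + b * w * real k" "0 < 1 + b * p" "0 < 1 + b * w * real (Suc k)"
    using w p assms by (auto intro!: add_pos_nonneg mult_nonneg_nonneg)
  have "p powr a \<le> (w / (1 + b * w * real k)) powr a"
    using Suc.IH w p pos assms(1) by (simp add: powr_divide powr_powr)
  then have "p \<le> w / (1 + b * w * real k)"
    using assms(1) w(1) p(1) pos(1) by (meson divide_nonneg_pos not_le powr_less_mono2)
  then have "p * (1 + b * w * real k) \<le> w"
    using pos by (simp add: pos_le_divide_eq)
  \<comment> \<open>After cross-multiplication the terms \<open>b * p * w\<close> cancel and the
    previous inequality remains. Nothing is divided by \<open>p\<close> or \<open>w\<close>, so
    vanishing gaps are covered.\<close>
  then have "p / (1 + b * p) \<le> w / (1 + b * w * real (Suc k))"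
    using pos by (simp add: field_simps)
  then have "(p / (1 + b * p)) powr a \<le> (w / (1 + b * w * real (Suc k))) powr a"
    using assms(1) p(1) pos(2) by (intro powr_mono2) auto
  then show ?case
    using rec[of k] w p pos assms(1) by (simp add: powr_divide powr_powr)
qed

text \<open>The step \<open>t = min 1 ((\<theta> / c) powr (1 / (\<sigma> - 1)))\<close> minimizes the right-hand side
  of \<open>descent\<close> over the unit interval.\<close>

lemma optimal_step_decrease:
  fixes \<theta> \<theta>' c \<sigma> :: real
  assumes \<sigma>: "1 < \<sigma>" "\<sigma> \<le> 2" and c: "0 < c" and \<theta>: "0 \<le> \<theta>"
    and descent: "\<And>t. 0 \<le> t \<Longrightarrow> t \<le> 1 \<Longrightarrow> \<theta>' \<le> \<theta> - t * \<theta> + c * t powr \<sigma> / \<sigma>"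
  shows "\<theta>' \<le> \<theta> / (1 + 1 / \<sigma> * c powr (1 / (1 - \<sigma>)) * \<theta> powr (1 / (\<sigma> - 1))) powr (\<sigma> - 1)"
proof -
  define a where "a = \<sigma> - 1"
  have a: "0 < a" "a \<le> 1" using \<sigma> by (auto simp: a_def)
  define w where "w = (\<theta> / c) powr (1 / a)"
  have w: "0 \<le> w" "w powr a = \<theta> / c"
    using a c \<theta> by (auto simp: w_def powr_powr)
  then have pos: "0 < 1 + w / \<sigma>"
    using \<sigma> by (simp add: add_pos_nonneg)
  have "c powr (1 / (1 - \<sigma>)) * \<theta> powr (1 / (\<sigma> - 1)) = w"
  proof -
    have "1 / (1 - \<sigma>) = - (1 / a)" using \<sigma> by (simp add: a_def field_simps)
    then show ?thesis using c \<theta>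
      by (simp add: w_def a_def[symmetric] powr_divide powr_minus_divide)
  qed
  then have eq: "1 / \<sigma> * c powr (1 / (1 - \<sigma>)) * \<theta> powr (1 / (\<sigma> - 1)) = w / \<sigma>"
    by (metis mult.assoc mult_1_left times_divide_eq_left)
  have *: "\<theta>' \<le> \<theta> / (1 + w / \<sigma>) powr a"
  proof (cases "w \<le> 1")
    case True
    have "w powr \<sigma> = w * w powr a"
      using w(1) powr_add[of w 1 a] by (simp add: a_def)
    then have "c * w powr \<sigma> = w * \<theta>"
      using w c by simp
    \<comment> \<open>The unconstrained minimizer \<open>w\<close> is an admissible step here; the
      two terms linear in \<open>w\<close> combine through
      \<open>1 - 1 / \<sigma> = a / \<sigma>\<close>.\<close>
    with descent[OF w(1) True] have "\<theta>' \<le> \<theta> * (1 - a * (w / \<sigma>))"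
      using \<sigma> by (simp add: a_def field_simps)
    \<comment> \<open>With \<open>s = a * (w / \<sigma>)\<close> the claim reduces to
      \<open>(1 - s) * (1 + s) \<le> 1\<close>; the bound \<open>s \<le> 1\<close> permits
      multiplying the estimate of the power by \<open>1 - s\<close>.\<close>
    also have "\<dots> \<le> \<theta> / (1 + w / \<sigma>) powr a"
    proof -
      have b: "(1 + w / \<sigma>) powr a \<le> 1 + a * (w / \<sigma>)"
        using a w \<sigma> by (intro powr_one_plus_le) auto
      have "a * (w / \<sigma>) \<le> 1"
        using a w \<sigma> True mult_le_one[of a w] by (simp add: field_simps)
      then have "(1 - a * (w / \<sigma>)) * (1 + w / \<sigma>) powr a
          \<le> (1 - a * (w / \<sigma>)) * (1 + a * (w / \<sigma>))"
        by (intro mult_left_mono b) simp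
      also have "\<dots> = 1 - (a * (w / \<sigma>))\<^sup>2" by (simp add: algebra_simps power2_eq_square)
      also have "\<dots> \<le> 1" by simp
      finally have "\<theta> * ((1 - a * (w / \<sigma>)) * (1 + w / \<sigma>) powr a) \<le> \<theta> * 1"
        using \<theta> by (intro mult_left_mono)
      moreover have "0 < (1 + w / \<sigma>) powr a"
        using pos by simp
      ultimately show ?thesis by (simp add: pos_le_divide_eq mult.assoc)
    qed
    finally show ?thesis .
  next
    case False
    \<comment> \<open>The full step \<open>t = 1\<close> leaves a gap of at most
      \<open>c / \<sigma>\<close>, so this value is compared with the bound. Since
      \<open>w > 1\<close>, a factor \<open>w\<close> can be pulled out, and
      \<open>w powr a = \<theta> / c\<close>.\<close>
    have "(1 + w / \<sigma>) powr a \<le> (w * (1 + 1 / \<sigma>)) powr a"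
      using False a \<sigma> by (intro powr_mono2) (auto simp: field_simps)
    also have "\<dots> = \<theta> / c * (1 + 1 / \<sigma>) powr a"
      using w \<sigma> by (simp add: powr_mult)
    also have "\<dots> \<le> \<theta> / c * \<sigma>"
    proof (intro mult_left_mono)
      have "(1 + 1 / \<sigma>) powr a \<le> 1 + a * (1 / \<sigma>)"
        using a \<sigma> by (intro powr_one_plus_le) auto
      also have "a * (1 / \<sigma>) \<le> a * 1"
        using a \<sigma> by (intro mult_left_mono) auto
      finally show "(1 + 1 / \<sigma>) powr a \<le> \<sigma>" by (simp add: a_def)
    qed (use c \<theta> in auto)
    finally have "c * (1 + w / \<sigma>) powr a \<le> \<theta> * \<sigma>"
      using c by (simp add: field_simps)
    moreover have "0 < (1 + w / \<sigma>) powr a"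
      using pos by simp
    ultimately have "c / \<sigma> \<le> \<theta> / (1 + w / \<sigma>) powr a"
      using \<sigma> by (simp add: field_simps)
    with descent[of 1] show ?thesis by simp
  qed
  then show ?thesis by (simp only: eq a_def)
qed

lemma fw_bound_of_descent:
  fixes \<theta> :: "nat \<Rightarrow> real" and c \<sigma> :: real
  assumes \<sigma>: "1 < \<sigma>" "\<sigma> \<le> 2" and c: "0 \<le> c" and nonneg: "\<And>k. 0 \<le> \<theta> k"
    and descent: "\<And>k t. 0 \<le> t \<Longrightarrow> t \<le> 1 \<Longrightarrow>
      \<theta> (Suc k) \<le> \<theta> k - t * \<theta> k + c * t powr \<sigma> / \<sigma>"
    and "1 \<le> k"
  shows "\<theta> k \<le> fw_bound \<sigma> c (\<theta> 0) k"
proof (cases "c = 0")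
  case True
  \<comment> \<open>Without curvature a full step from iterate \<open>k - 1\<close> closes the gap
    entirely; a predecessor exists because \<open>1 \<le> k\<close>.\<close>
  with descent[of 1 "k - 1"] \<open>1 \<le> k\<close> show ?thesis by (simp add: fw_bound_def)
next
  case False
  with c have c: "0 < c" by simp
  have "\<theta> k \<le> \<theta> 0 / (1 + (1 / \<sigma> * c powr (1 / (1 - \<sigma>))) * \<theta> 0 powr (1 / (\<sigma> - 1)) * real k)
      powr (\<sigma> - 1)"
    using \<sigma> nonneg optimal_step_decrease[OF \<sigma> c nonneg descent]
    by (intro rate_of_recursion) auto
  with False show ?thesis by (simp add: fw_bound_def ac_simps)
qed

text \<open>Dropping the summand 1 in the denominator gives the rate. Positivity of \<open>b\<close>
  is asked only for \<open>\<theta> \<noteq> 0\<close> because in \<open>fw_bound\<close> this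
  coefficient contains a power of \<open>\<theta>\<close> and vanishes with it.\<close>

lemma rate_bigo:
  fixes a b \<theta> :: real
  assumes "0 \<le> a" and b: "\<theta> \<noteq> 0 \<Longrightarrow> 0 < b"
  shows "(\<lambda>k. \<theta> / (1 + b * real k) powr a) \<in> O(\<lambda>k. 1 / real k powr a)"
proof (cases "\<theta> = 0")
  case False
  with b have b: "0 < b" by simp
  have "norm (\<theta> / (1 + b * real k) powr a) \<le> (\<bar>\<theta>\<bar> / b powr a) * norm (1 / real k powr a)"
    if "k \<ge> 1" for k
  proof -
    have "(b * real k) powr a \<le> (1 + b * real k) powr a"
      using b assms(1) by (intro powr_mono2) auto
    moreover have "0 < (b * real k) powr a" using b that by simp
    ultimately have "\<bar>\<theta>\<bar> / (1 + b * real k) powr a \<le> \<bar>\<theta>\<bar> / (b * real k) powr a"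
      by (intro divide_left_mono mult_pos_pos) auto
    then show ?thesis using b by (simp add: powr_mult)
  qed
  then show ?thesis
    by (intro bigoI[where c = "\<bar>\<theta>\<bar> / b powr a"] eventually_sequentiallyI[of 1])
qed simp

lemma fw_bound_bigo:
  assumes "1 < \<sigma>" "0 \<le> c" "0 \<le> \<theta>"
  shows "fw_bound \<sigma> c \<theta> \<in> O(\<lambda>k. 1 / real k powr (\<sigma> - 1))"
proof (cases "c = 0")
  case False
  with assms show ?thesis unfolding fw_bound_def
    by (simp only: if_False) (intro rate_bigo, auto)
qed (simp add: fw_bound_def[abs_def])

section \<open>Calculus along line segments\<close>

lemma has_real_derivative_along_line:
  fixes f :: "'a::real_normed_vector \<Rightarrow> real"
  assumes "\<And>z. (f has_derivative blinfun_apply (f' z)) (at z)"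
  shows "((\<lambda>t. f (z + t *\<^sub>R d)) has_real_derivative f' (z + t *\<^sub>R d) d) (at t)"
proof -
  have "((\<lambda>t. f (z + t *\<^sub>R d)) has_derivative (\<lambda>h. f' (z + t *\<^sub>R d) (h *\<^sub>R d))) (at t)"
    by (rule has_derivative_compose[OF _ assms]) (auto intro!: derivative_eq_intros)
  then show ?thesis
    by (rule has_derivative_imp_has_field_derivative) (simp add: blinfun.scaleR_right)
qed

text \<open>Restricting \<open>f\<close> to the line through \<open>z\<close> and \<open>y\<close>
  reduces this to the tangent inequality for a convex function of one real variable, compared at 0
  and 1.\<close>

lemma convex_above_tangent:
  fixes f :: "'a::real_normed_vector \<Rightarrow> real"
  assumes cvx: "convex_on UNIV f" and f': "\<And>z. (f has_derivative blinfun_apply (f' z)) (at z)"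
  shows "f z + f' z (y - z) \<le> f y"
proof -
  have "convex_on UNIV (\<lambda>t. f (z + t *\<^sub>R (y - z)))"
  proof (rule convex_onI)
    fix t u v :: real assume "0 < t" "t < 1"
    moreover have "z + ((1 - t) *\<^sub>R u + t *\<^sub>R v) *\<^sub>R (y - z)
        = (1 - t) *\<^sub>R (z + u *\<^sub>R (y - z)) + t *\<^sub>R (z + v *\<^sub>R (y - z))"
      by (simp add: algebra_simps)
    ultimately show "f (z + ((1 - t) *\<^sub>R u + t *\<^sub>R v) *\<^sub>R (y - z))
        \<le> (1 - t) * f (z + u *\<^sub>R (y - z)) + t * f (z + v *\<^sub>R (y - z))"
      using convex_onD[OF cvx, of t] by simp
  qed simp
  from convex_on_imp_above_tangent[OF this, of 0 1, OF _ _ _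
      has_real_derivative_along_line[of f f' z "y - z" 0, OF f']]
  show ?thesis by simp
qed

lemma holder_descent:
  fixes f :: "'a::real_normed_vector \<Rightarrow> real"
  assumes f': "\<And>z. (f has_derivative blinfun_apply (f' z)) (at z)"
    and "holder_with \<nu> L f'" "0 < \<nu>"
  shows "f (z + d) - f z - f' z d \<le> L / (1 + \<nu>) * norm d powr (1 + \<nu>)"
proof -
  define K where "K = L * norm d powr (1 + \<nu>)"
  define h where "h t = f (z + t *\<^sub>R d) - t * f' z d - K / (1 + \<nu>) * t powr (1 + \<nu>)" for t
  have "h 1 \<le> h 0"
  \<comment> \<open>Derivatives are taken only at interior points, which avoids differentiating the
    power at 0; the endpoints enter through continuity.\<close>
  proof (rule DERIV_nonpos_imp_decreasing_open[where f = h])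
    fix t :: real assume t: "0 < t" "t < 1"
    have "(h has_real_derivative f' (z + t *\<^sub>R d) d - f' z d - K * t powr \<nu>) (at t)"
      unfolding h_def using t \<open>0 < \<nu>\<close>
      by (auto intro!: derivative_eq_intros has_real_derivative_along_line[where f' = f'] f')
    moreover have "f' (z + t *\<^sub>R d) d - f' z d \<le> K * t powr \<nu>"
    proof -
      have "(f' (z + t *\<^sub>R d) - f' z) d \<le> norm (f' (z + t *\<^sub>R d) - f' z) * norm d"
        using norm_blinfun[of "f' (z + t *\<^sub>R d) - f' z" d] by simp
      also have "\<dots> \<le> (L * norm (t *\<^sub>R d) powr \<nu>) * norm d"
        using assms(2)[unfolded holder_with_def, rule_format, of "z + t *\<^sub>R d" z]
        by (intro mult_right_mono) simp_all
      also have "\<dots> = K * t powr \<nu>"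
        using t \<open>0 < \<nu>\<close> by (simp add: K_def powr_mult powr_mult_base[symmetric] mult_ac)
      finally show ?thesis by (simp add: blinfun.diff_left)
    qed
    ultimately show "\<exists>y. (h has_real_derivative y) (at t) \<and> y \<le> 0" by force
  next
    have "continuous_on {0..1} (\<lambda>t. f (z + t *\<^sub>R d))"
      using has_real_derivative_along_line[of f f', OF f']
      by (meson DERIV_continuous continuous_at_imp_continuous_on)
    then show "continuous_on {0..1} h"
      unfolding h_def using \<open>0 < \<nu>\<close> by (intro continuous_intros continuous_on_powr') auto
  qed simp
  then show ?thesis by (simp add: h_def K_def)
qed

section \<open>The curvature constant\<close>

lemma curvature_const_nonneg:
  fixes f :: "'a::real_normed_vector \<Rightarrow> real"
  assumes "C \<noteq> {}"
  shows "0 \<le> curvature_const \<sigma> f f' C"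
proof -
  from assms obtain z where "z \<in> C" by blast
  \<comment> \<open>The degenerate choice \<open>x = s = z\<close> contributes the value 0 to the
    supremum.\<close>
  then show ?thesis unfolding curvature_const_def
    by (intro Sup_upper CollectI exI[of _ z] exI[of _ "1 :: real"]) (auto simp: blinfun.zero_right)
qed

lemma curvature_const_bound:
  fixes f :: "'a::real_normed_vector \<Rightarrow> real"
  assumes "curvature_const \<sigma> f f' C < \<infinity>" "z \<in> C" "s \<in> C" "0 < t" "t \<le> 1" "0 < \<sigma>"
  shows "f (z + t *\<^sub>R (s - z)) - f z - f' z (t *\<^sub>R (s - z))
    \<le> real_of_ereal (curvature_const \<sigma> f f' C) * t powr \<sigma> / \<sigma>"
proof -
  let ?y = "z + t *\<^sub>R (s - z)"
  let ?e = "f ?y - f z - f' z (?y - z)"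
  have "ereal (\<sigma> / t powr \<sigma> * ?e) \<le> curvature_const \<sigma> f f' C"
    unfolding curvature_const_def using assms(2-5) by (intro Sup_upper) blast
  \<comment> \<open>Being finite and nonnegative, the supremum is a genuine real, so
    \<open>real_of_ereal\<close> loses nothing.\<close>
  moreover have "0 \<le> curvature_const \<sigma> f f' C"
    using assms(2) by (intro curvature_const_nonneg) auto
  ultimately have "\<sigma> / t powr \<sigma> * ?e \<le> real_of_ereal (curvature_const \<sigma> f f' C)"
    using assms(1) by (cases "curvature_const \<sigma> f f' C") auto
  then show ?thesis using assms by (simp add: field_simps)
qed

section \<open>One step of the method in real arithmetic\<close>

lemma convex_on_real_of_ereal:
  assumes "convex_ereal g" "convex C" and fin: "\<And>z. z \<in> C \<Longrightarrow> \<bar>g z\<bar> \<noteq> \<infinity>"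
  shows "convex_on C (\<lambda>z. real_of_ereal (g z))"
proof (rule convex_onI)
  fix t :: real and u v assume t: "0 < t" "t < 1" and uv: "u \<in> C" "v \<in> C"
  let ?w = "(1 - t) *\<^sub>R u + t *\<^sub>R v"
  have "?w \<in> C"
    using t uv \<open>convex C\<close> by (simp add: convex_alt)
  moreover have "g ?w \<le> ereal (1 - t) * g u + ereal t * g v"
    using t assms(1) unfolding convex_ereal_def by simp
  ultimately show "real_of_ereal (g ?w) \<le> (1 - t) * real_of_ereal (g u) + t * real_of_ereal (g v)"
    using fin[OF uv(1)] fin[OF uv(2)] fin[of ?w]
    by (cases "g u"; cases "g v"; cases "g ?w") auto
qed fact

text \<open>The linearized objective decreases along the segment by at least \<open>t\<close> times
  its gap between \<open>z\<close> and \<open>s\<close>, and \<open>r\<close> absorbs the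
  linearization error. The comparison point \<open>u\<close> is later a minimizer of the
  objective.\<close>

lemma frank_wolfe_descent:
  fixes f :: "'a::real_normed_vector \<Rightarrow> real"
  assumes "convex_on UNIV f" "\<And>z. (f has_derivative blinfun_apply (f' z)) (at z)"
    and G: "convex_on C G" and z: "z \<in> C" and s: "s \<in> C" and u: "u \<in> C"
    and min: "f' z s + G s \<le> f' z u + G u" and t: "0 \<le> t" "t \<le> 1"
    and curv: "f (z + t *\<^sub>R (s - z)) - f z - f' z (t *\<^sub>R (s - z)) \<le> r"
  shows "f (z + t *\<^sub>R (s - z)) + G (z + t *\<^sub>R (s - z))
    \<le> f z + G z - t * (f z + G z - (f u + G u)) + r"
proof -
  have "z + t *\<^sub>R (s - z) = (1 - t) *\<^sub>R z + t *\<^sub>R s" by (simp add: algebra_simps)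
  then have "G (z + t *\<^sub>R (s - z)) \<le> (1 - t) * G z + t * G s"
    using convex_onD[OF G t z s] by simp
  \<comment> \<open>The tangent inequality at \<open>z\<close> bounds the true gap to
    \<open>u\<close> by the linearized one, and \<open>s\<close> does at least as well as
    \<open>u\<close> in the subproblem.\<close>
  moreover have "f z + G z - (f u + G u) \<le> f' z z - f' z s + G z - G s"
    using convex_above_tangent[OF assms(1,2), of z u] min by (simp add: blinfun.diff_right)
  then have "t * (f z + G z - (f u + G u)) \<le> t * (f' z z - f' z s + G z - G s)"
    using t by (intro mult_left_mono)
  ultimately show ?thesis
    using curv by (simp add: blinfun.diff_right blinfun.scaleR_right algebra_simps)
qed

section \<open>Convergence under line minimization\<close>

theorem theorem5p4:
  fixes C :: "'a::banach set"
    and f :: "'a \<Rightarrow> real"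
    and f' :: "'a \<Rightarrow> 'a \<Rightarrow>\<^sub>L real"
    and g :: "'a \<Rightarrow> ereal"
    and x xbar :: "nat \<Rightarrow> 'a"
    and \<gamma> :: "nat \<Rightarrow> real"
    and \<phi> :: "'a \<Rightarrow> ereal"
    and \<phi>_min :: ereal
    and \<theta>\<^sub>0 \<delta> :: real
  assumes C: "C \<noteq> {}" "closed C" "bounded C" "convex C"
    and \<delta>: "\<delta> = diameter C"
    and f_convex: "convex_on UNIV f"
    and f_deriv: "\<And>z. (f has_derivative blinfun_apply (f' z)) (at z)"
    and f'_cont: "continuous_on UNIV f'"
    and g: "proper_fun g" "lower_semicontinuous g" "convex_ereal g"
    and dom_g: "C \<subseteq> {z. g z < \<infinity>}"
    and \<phi>: "\<phi> = (\<lambda>z. ereal (f z) + g z)"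
    and min_attained: "\<exists>z. is_arg_min \<phi> (\<lambda>z. z \<in> C) z"
    and \<phi>_min: "\<phi>_min = (INF z\<in>C. \<phi> z)"
    and alg: "generalized_frank_wolfe f' g C x xbar \<gamma>"
    and step: "line_minimization \<phi> x xbar \<gamma>"
    and \<theta>\<^sub>0: "\<theta>\<^sub>0 = real_of_ereal (\<phi> (x 0) - \<phi>_min)"
  shows
    "(\<forall>\<sigma>. 1 < \<sigma> \<longrightarrow> \<sigma> \<le> 2 \<longrightarrow> curvature_const \<sigma> f f' C < \<infinity> \<longrightarrow>
        (let B = fw_bound \<sigma> (real_of_ereal (curvature_const \<sigma> f f' C)) \<theta>\<^sub>0
         in (\<forall>k\<ge>1. \<phi> (x k) - \<phi>_min \<le> ereal (B k)) \<and>
            B \<in> O(\<lambda>k. 1 / real k powr (\<sigma> - 1))))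
     \<and> (\<forall>\<nu> L. 0 < \<nu> \<longrightarrow> \<nu> \<le> 1 \<longrightarrow> 0 < L \<longrightarrow> holder_with \<nu> L f' \<longrightarrow>
        (let B = (\<lambda>k. \<theta>\<^sub>0 / (1 + 1 / (1 + \<nu>) * \<theta>\<^sub>0 powr (1 / \<nu>)
                          * (L * \<delta> powr (1 + \<nu>)) powr (- (1 / \<nu>)) * real k) powr \<nu>)
         in (\<forall>k\<ge>1. \<phi> (x k) - \<phi>_min \<le> ereal (B k)) \<and>
            B \<in> O(\<lambda>k. 1 / real k powr \<nu>)))
     \<and> (\<forall>L. 0 < L \<longrightarrow> L-lipschitz_on UNIV f' \<longrightarrow>
        (let B = (\<lambda>k. \<theta>\<^sub>0 / (1 + \<theta>\<^sub>0 / (2 * L * \<delta>\<^sup>2) * real k))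
         in (\<forall>k\<ge>1. \<phi> (x k) - \<phi>_min \<le> ereal (B k)) \<and>
            B \<in> O(\<lambda>k. 1 / real k)))"
proof -
  \<comment> \<open>Real representatives of \<open>g\<close> and \<open>\<phi>\<close>, faithful on
    \<open>C\<close>, where all iterates, subproblem solutions and trial points lie.\<close>
  define G where "G z = real_of_ereal (g z)" for z
  define \<Phi> where "\<Phi> z = f z + G z" for z
  have fin: "\<bar>g z\<bar> \<noteq> \<infinity>" if "z \<in> C" for z
    using that dom_g g(1) by (auto simp: proper_fun_def)
  then have g_eq: "g z = ereal (G z)" if "z \<in> C" for z
    using that by (simp add: G_def ereal_real)
  then have \<phi>_eq: "\<phi> z = ereal (\<Phi> z)" if "z \<in> C" for z
    using that by (simp add: \<phi> \<Phi>_def)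
  have G_convex: "convex_on C G"
    unfolding G_def by (rule convex_on_real_of_ereal[OF g(3) C(4) fin])
  obtain u where u: "u \<in> C" and u_min: "\<And>z. z \<in> C \<Longrightarrow> \<Phi> u \<le> \<Phi> z"
  proof -
    obtain u where "u \<in> C" "\<forall>z\<in>C. \<phi> u \<le> \<phi> z"
      using min_attained by (auto simp: is_arg_min_linorder)
    then show thesis using that \<phi>_eq by auto
  qed
  have "\<phi>_min = \<phi> u"
    unfolding \<phi>_min using u u_min \<phi>_eq by (intro antisym INF_lower INF_greatest) auto
  then have \<phi>_min_eq: "\<phi>_min = ereal (\<Phi> u)" using \<phi>_eq[OF u] by simp
  have in_segment: "z + t *\<^sub>R (s - z) \<in> C" if "z \<in> C" "s \<in> C" "0 \<le> t" "t \<le> 1" for z s and t :: real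
    using that C(4) by (simp add: convex_alt algebra_simps)
  have xbar: "xbar k \<in> C"
    and xbar_min: "\<And>z. z \<in> C \<Longrightarrow> f' (x k) (xbar k) + G (xbar k) \<le> f' (x k) z + G z"
    and x_Suc: "x (Suc k) = x k + \<gamma> k *\<^sub>R (xbar k - x k)" for k
  proof -
    have *: "xbar k \<in> C" "\<forall>z\<in>C. ereal (f' (x k) (xbar k)) + g (xbar k) \<le> ereal (f' (x k) z) + g z"
      "x (Suc k) = x k + \<gamma> k *\<^sub>R (xbar k - x k)"
      using alg unfolding generalized_frank_wolfe_def is_arg_min_linorder by blast+
    then show "xbar k \<in> C" "x (Suc k) = x k + \<gamma> k *\<^sub>R (xbar k - x k)" by auto
    show "f' (x k) (xbar k) + G (xbar k) \<le> f' (x k) z + G z" if "z \<in> C" for z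
      using *(1,2) g_eq that by force
  qed
  \<comment> \<open>Optimality of \<open>\<gamma> k\<close> makes the next iterate at least as good
    as any trial step \<open>t\<close>, so later estimates may choose \<open>t\<close>
    freely.\<close>
  have \<gamma>: "0 \<le> \<gamma> k" "\<gamma> k \<le> 1"
    and \<gamma>_min: "0 \<le> t \<Longrightarrow> t \<le> 1 \<Longrightarrow> \<phi> (x (Suc k)) \<le> \<phi> (x k + t *\<^sub>R (xbar k - x k))" for k t
    using step unfolding line_minimization_def is_arg_min_linorder x_Suc by auto
  have x: "x k \<in> C" for k
  proof (induction k)
    case 0
    show ?case using alg by (simp add: generalized_frank_wolfe_def)
  next
    case (Suc k)
    then show ?case unfolding x_Suc by (intro in_segment xbar \<gamma>)
  qed
  define \<theta> where "\<theta> k = \<Phi> (x k) - \<Phi> u" for k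
  have gap: "\<phi> (x k) - \<phi>_min = ereal (\<theta> k)" for k
    by (simp add: \<phi>_eq[OF x] \<phi>_min_eq \<theta>_def)
  have \<theta>_nonneg: "0 \<le> \<theta> k" for k
    using u_min[OF x] by (simp add: \<theta>_def)
  have \<theta>0: "\<theta>\<^sub>0 = \<theta> 0" unfolding \<theta>\<^sub>0 gap by simp
  \<comment> \<open>Any \<open>c\<close> satisfying the curvature inequality is allowed, so the
    curvature constant and the Hoelder estimate can both be inserted without comparing bounds for
    different \<open>c\<close>.\<close>
  have bound: "\<theta> k \<le> fw_bound \<sigma> c \<theta>\<^sub>0 k"
    if \<sigma>: "1 < \<sigma>" "\<sigma> \<le> 2" and c: "0 \<le> c" and k: "1 \<le> k"
      and curv: "\<And>z s t. z \<in> C \<Longrightarrow> s \<in> C \<Longrightarrow> 0 < t \<Longrightarrow> t \<le> 1 \<Longrightarrow>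
        f (z + t *\<^sub>R (s - z)) - f z - f' z (t *\<^sub>R (s - z)) \<le> c * t powr \<sigma> / \<sigma>"
    for \<sigma> c k
    unfolding \<theta>0
  proof (rule fw_bound_of_descent[OF \<sigma> c \<theta>_nonneg _ k])
    fix k and t :: real assume t: "0 \<le> t" "t \<le> 1"
    let ?y = "x k + t *\<^sub>R (xbar k - x k)"
    have "f ?y - f (x k) - f' (x k) (t *\<^sub>R (xbar k - x k)) \<le> c * t powr \<sigma> / \<sigma>"
      \<comment> \<open>The curvature inequality covers only \<open>t > 0\<close>; at
        \<open>t = 0\<close> both sides vanish, as \<open>0 powr \<sigma> = 0\<close>.\<close>
      using curv[OF x xbar, of t k k] t by (cases "t = 0") (auto simp: blinfun.zero_right)
    then have "\<Phi> ?y \<le> \<Phi> (x k) - t * (\<Phi> (x k) - \<Phi> u) + c * t powr \<sigma> / \<sigma>"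
      unfolding \<Phi>_def
      by (rule frank_wolfe_descent[OF f_convex f_deriv G_convex x xbar u xbar_min[OF u] t])
    moreover have "\<Phi> (x (Suc k)) \<le> \<Phi> ?y"
      using \<gamma>_min[OF t, of k] in_segment[OF x xbar t] \<phi>_eq x by simp
    ultimately show "\<theta> (Suc k) \<le> \<theta> k - t * \<theta> k + c * t powr \<sigma> / \<sigma>"
      by (simp add: \<theta>_def)
  qed

  \<comment> \<open>Rates for the three smoothness assumptions\<close>
  have general: "(\<forall>k\<ge>1. \<theta> k \<le> B k) \<and> B \<in> O(\<lambda>k. 1 / real k powr (\<sigma> - 1))"
    if \<sigma>: "1 < \<sigma>" "\<sigma> \<le> 2" and fin: "curvature_const \<sigma> f f' C < \<infinity>"
      and B: "B = fw_bound \<sigma> (real_of_ereal (curvature_const \<sigma> f f' C)) \<theta>\<^sub>0" for \<sigma> B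
  proof -
    let ?c = "real_of_ereal (curvature_const \<sigma> f f' C)"
    have c: "0 \<le> ?c" by (intro real_of_ereal_pos curvature_const_nonneg C)
    have "\<theta> k \<le> fw_bound \<sigma> ?c \<theta>\<^sub>0 k" if "1 \<le> k" for k
      using \<sigma> by (intro bound c that curvature_const_bound fin) auto
    then show ?thesis
      unfolding B using \<sigma>(1) c \<theta>_nonneg[of 0] \<theta>0 by (auto intro: fw_bound_bigo)
  qed

  have holder: "(\<forall>k\<ge>1. \<theta> k \<le> B k) \<and> B \<in> O(\<lambda>k. 1 / real k powr \<nu>)"
    if \<nu>: "0 < \<nu>" "\<nu> \<le> 1" and L: "0 < L" and f'_holder: "holder_with \<nu> L f'"
      and B: "B = (\<lambda>k. \<theta>\<^sub>0 / (1 + 1 / (1 + \<nu>) * \<theta>\<^sub>0 powr (1 / \<nu>)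
                          * (L * \<delta> powr (1 + \<nu>)) powr (- (1 / \<nu>)) * real k) powr \<nu>)" for \<nu> L B
  proof (cases "\<delta> = 0")
    \<comment> \<open>Here \<open>C\<close> is a single point, so all gaps and hence
      \<open>B\<close> are 0. The other case then has \<open>0 < c\<close>.\<close>
    case True
    have "x k = u" for k
      using diameter_bounded_bound[OF C(3) x[of k] u] True \<delta> by simp
    then have "\<theta> k = 0" for k by (simp add: \<theta>_def)
    then show ?thesis by (simp add: B \<theta>0)
  next
    case False
    then have \<delta>_pos: "0 < \<delta>"
      using diameter_ge_0[OF C(3)] \<delta> by simp
    define c where "c = L * \<delta> powr (1 + \<nu>)"
    have c: "0 < c" using L \<delta>_pos by (simp add: c_def)
    \<comment> \<open>For \<open>\<sigma> = 1 + \<nu>\<close> the exponent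
      \<open>1 / (1 - \<sigma>)\<close> is \<open>- (1 / \<nu>)\<close>.\<close>
    have B_eq: "B = fw_bound (1 + \<nu>) c \<theta>\<^sub>0"
      unfolding B c_def[symmetric] using c by (simp add: fw_bound_def fun_eq_iff)
    have "\<theta> k \<le> fw_bound (1 + \<nu>) c \<theta>\<^sub>0 k" if "1 \<le> k" for k
    proof (rule bound)
      fix z s and t :: real assume zs: "z \<in> C" "s \<in> C" and t: "0 < t" "t \<le> 1"
      have "norm (t *\<^sub>R (s - z)) \<le> t * \<delta>"
        using diameter_bounded_bound[OF C(3) zs(2,1)] t by (simp add: \<delta> dist_norm)
      then have "norm (t *\<^sub>R (s - z)) powr (1 + \<nu>) \<le> (t * \<delta>) powr (1 + \<nu>)"
        using \<nu> by (intro powr_mono2) auto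
      then have "L / (1 + \<nu>) * norm (t *\<^sub>R (s - z)) powr (1 + \<nu>) \<le> L / (1 + \<nu>) * (t * \<delta>) powr (1 + \<nu>)"
        using \<nu> L by (intro mult_left_mono) auto
      also have "\<dots> = c * t powr (1 + \<nu>) / (1 + \<nu>)"
        using t \<delta>_pos by (simp add: c_def powr_mult)
      finally show "f (z + t *\<^sub>R (s - z)) - f z - f' z (t *\<^sub>R (s - z)) \<le> c * t powr (1 + \<nu>) / (1 + \<nu>)"
        using holder_descent[of f f' \<nu> L z "t *\<^sub>R (s - z)", OF f_deriv f'_holder \<nu>(1)] by simp
    qed (use \<nu> c that in auto)
    moreover have "fw_bound (1 + \<nu>) c \<theta>\<^sub>0 \<in> O(\<lambda>k. 1 / real k powr (1 + \<nu> - 1))"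
      using \<nu> c \<theta>_nonneg[of 0] \<theta>0 by (intro fw_bound_bigo) auto
    ultimately show ?thesis unfolding B_eq by simp
  qed

  have lipschitz: "(\<forall>k\<ge>1. \<theta> k \<le> B k) \<and> B \<in> O(\<lambda>k. 1 / real k)"
    if L: "0 < L" "L-lipschitz_on UNIV f'"
      and B: "B = (\<lambda>k. \<theta>\<^sub>0 / (1 + \<theta>\<^sub>0 / (2 * L * \<delta>\<^sup>2) * real k))" for L B
  proof -
    have \<delta>_nonneg: "0 \<le> \<delta>" using diameter_ge_0[OF C(3)] \<delta> by simp
    have "holder_with 1 L f'"
      using lipschitz_onD[OF L(2)] by (simp add: holder_with_def dist_norm)
    \<comment> \<open>This is the Hoelder bound at \<open>\<nu> = 1\<close>, with
      \<open>1 + \<nu>\<close> supplying the factor 2. The forms agree even for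
      \<open>\<delta> = 0\<close>, where the quotient and the negative power both evaluate to
      0.\<close>
    moreover have "B = (\<lambda>k. \<theta>\<^sub>0 / (1 + 1 / (1 + 1) * \<theta>\<^sub>0 powr (1 / 1)
        * (L * \<delta> powr (1 + 1)) powr (- (1 / 1)) * real k) powr 1)"
    proof
      fix k
      \<comment> \<open>The outer power \<open>powr 1\<close> is the identity only on nonnegative
        arguments.\<close>
      have "0 \<le> \<theta>\<^sub>0 / (2 * L * \<delta>\<^sup>2) * real k"
        using L \<theta>_nonneg[of 0] \<theta>0 by simp
      then show "B k = \<theta>\<^sub>0 / (1 + 1 / (1 + 1) * \<theta>\<^sub>0 powr (1 / 1)
        * (L * \<delta> powr (1 + 1)) powr (- (1 / 1)) * real k) powr 1"
        using L \<theta>_nonneg[of 0] \<theta>0 \<delta>_nonneg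
        by (simp add: B powr_minus_divide powr_numeral mult_ac)
    qed
    ultimately have "(\<forall>k\<ge>1. \<theta> k \<le> B k) \<and> B \<in> O(\<lambda>k. 1 / real k powr 1)"
      using L by (intro holder) auto
    then show ?thesis by simp
  qed

  show ?thesis
    unfolding Let_def gap ereal_less_eq
    using general[OF _ _ _ refl] holder[OF _ _ _ _ refl] lipschitz[OF _ _ refl] by blast
qed

end
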